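(* Consider the timestamp algorithm for unsorted relators (Algorithm B, given in full in the context), which is used when the relator sequence $\mathbf{Rel}$ of a finitely presented group is not necessarily kept sorted within a pass, and which is applicable if $R_k$ remains the $k$th relator in $\mathbf{Rel}$ throughout a pass, no matter whether it is changed or not, while at the beginning of each pass $\mathbf{Rel}$ is sorted. This algorithm performs all necessary searches, and all searches the algorithm does are necessary.
   Context: **Relators.** Let $G=\langle g_1,\dots,g_d\mid R_1,\dots,R_q\rangle$ be a finite group presentation, with relators regarded as strings over $\Sigma=\{g_1,g_1^{-1},\dots,g_d,g_d^{-1}\}$; $l_i$ (also written $R[i].len$) is the length of $R_i$. $\mathbf{Rel}$ is the sequence of relators $\langle R_1,\dots,R_q\rangle$; it is sorted when $l_1\le l_2\le\cdots\le l_q$. The equivalents of a relator are its rotations and their formal inverses (reverse the string and invert each symbol). **Search.** For relators $R_p$ (pattern) and $R_t$ (text) with $l_p\le l_t$, the search $ComStr(R_p,R_t)$ determines whether equivalents of $R_p$ and $R_t$ have a common substring of length at least $\lceil (l_p+1)/2\rceil$ (a useful common substring, i.e. one of length greater than half the length of the shorter relator) and, if so, shortens $R_t$: if $v$ is a matching substring in a rotation $uv$ of $R_p$ or its inverse and in a rotation $wv$ of $R_t$, with $v$ longer than $u$, then $R_t$ is replaced by $wu^{-1}$. **Pass and necessary search.** A pass is a substring replacement phase in which each pair of relators in $\mathbf{Rel}$ is considered once and only once for a $ComStr(R_p,R_t)$. If at least one of $R_p$ and $R_t$ has been changed since the previous $ComStr(R_p,R_t)$, then $ComStr(R_p,R_t)$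 is a necessary search in the current pass; otherwise it is unnecessary (since it is then impossible that these relators have a useful common substring). **Algorithm B.** $R[i].Tp$ records the latest time when $R_i$ is used as a pattern; $R[i].Ts$ records the latest time when $R_i$ is changed in a search $ComStr(R_p,R_i)$. TsLocal is an auxiliary array indexed by relator position, NumRels is the number of relators, and MoreSubstringSearchPass is the condition that decides whether another pass is made. The symbol $*$ stands for every relator index, so that the initialization sets $R[i].Tp$ and $R[i].Ts$ to $i$ for each $i$. ``` Initialize: R[*].Tp := R[*].Ts := *; while (MoreSubstringSearchPass) { TsLocal[*] := 0; for p := 1 to NumRels-1 { for t := p+1 to NumRels { if (R[t].len >= R[p].len and ( (TsLocal[p]+TsLocal[t])!=0 or R[p].Tp > R[t].Tp or R[p].Tp <= R[t].Ts) ) { ComStr(R[p],R[t]); if (R[t] changed) TsLocal[t] := p; } } R[p].Tp := p; R[p].Ts := TsLocal[p]; } Sort(Rel); Other operations; Compute MoreSubstringSearchPass; } ``` Here Sort(Rel) sorts the relator sequence by length, and "Other operations" refers to elimination phases (in which generators and associated relators are eliminated), which are also responsible for updating $R[*].Tp$, $R[*].Ts$ and NumRels, as appropriate.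
   Formalization: Between passes the last relator also gets Tp := NumRels, Ts := TsLocal[NumRels]; Sort(Rel) is stable; eliminations keep stamps and order of unchanged relators and give changed ones Tp = Ts above all kept Tp. Without the first two, unnecessary searches occur. *)

theory Defs
  imports Complex_Main "HOL-Library.Sublist"
begin

text \<open>
  Letters: \<open>(k, True)\<close> stands for the generator \<open>g\<^sub>k\<close> and \<open>(k, False)\<close> for its formal inverse.
  Words are plain strings; nothing is freely or cyclically reduced.
\<close>

type_synonym letter = "nat \<times> bool"
type_synonym word = "letter list"

definition alphabet :: "nat \<Rightarrow> letter set" where
  "alphabet d = {1..d} \<times> UNIV"

definition inverse_word :: "word \<Rightarrow> word" where
  "inverse_word w = map (\<lambda>(k, e). (k, \<not> e)) (rev w)"

definition rotations :: "word \<Rightarrow> word set" where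
  "rotations w = range (\<lambda>n. rotate n w)"

definition equivalents :: "word \<Rightarrow> word set" where
  "equivalents w = rotations w \<union> inverse_word ` rotations w"

definition useful_common_substring :: "word \<Rightarrow> word \<Rightarrow> word \<Rightarrow> bool" where
  "useful_common_substring P T v \<longleftrightarrow>
     (\<exists>x\<in>equivalents P. \<exists>y\<in>equivalents T. sublist v x \<and> sublist v y)
     \<and> nat \<lceil>(real (length P) + 1) / 2\<rceil> \<le> length v"

text \<open>
  \<open>ComStr P T T'\<close>: searching with pattern \<open>P\<close> and text \<open>T\<close> may leave the text as \<open>T'\<close>. It is a
  relation because the choice among several useful common substrings is left open. The set
  \<open>equivalents P\<close> consists of the rotations of \<open>P\<close> and of the inverse of \<open>P\<close>.
\<close>

definition ComStr :: "word \<Rightarrow> word \<Rightarrow> word \<Rightarrow> bool" where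
  "ComStr P T T' \<longleftrightarrow>
     (if \<exists>v. useful_common_substring P T v
      then \<exists>u v w. u @ v \<in> equivalents P \<and> w @ v \<in> rotations T \<and> length u < length v
             \<and> T' = w @ inverse_word u
      else T' = T)"

text \<open>
  A relator carries an identity \<open>ident\<close>, which stays with it when its word is changed and when the
  sequence is sorted. Neither \<open>ident\<close> nor the history \<open>hist\<close> (in chronological order) influences
  the algorithm; they serve to express when a search is necessary.
\<close>

record relator =
  ident :: nat
  word :: word
  Tp :: nat
  Ts :: nat

datatype event =
    Search nat nat  \<comment> \<open>identities of the pattern and of the text\<close>
  | Change nat

record state =
  Rel :: "relator list"
  TsLocal :: "nat \<Rightarrow> nat"
  hist :: "event list"

abbreviation NumRels :: "state \<Rightarrow> nat" where
  "NumRels s \<equiv> length (Rel s)"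

abbreviation len :: "relator \<Rightarrow> nat" where
  "len r \<equiv> length (word r)"

text \<open>Positions count from 1: the test \<open>TsLocal \<noteq> 0\<close> relies on it.\<close>

definition R :: "state \<Rightarrow> nat \<Rightarrow> relator" where
  "R s k = Rel s ! (k - 1)"

definition set_R :: "nat \<Rightarrow> relator \<Rightarrow> state \<Rightarrow> state" where
  "set_R k r s = s\<lparr>Rel := (Rel s)[k - 1 := r]\<rparr>"

definition guard :: "state \<Rightarrow> nat \<Rightarrow> nat \<Rightarrow> bool" where
  "guard s p t \<longleftrightarrow>
     len (R s t) \<ge> len (R s p) \<and>
     (TsLocal s p + TsLocal s t \<noteq> 0 \<or> Tp (R s p) > Tp (R s t) \<or> Tp (R s p) \<le> Ts (R s t))"

text \<open>
  A change made by a search is recorded after that search, so that it counts as a change since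
  that search.
\<close>

definition search :: "nat \<Rightarrow> nat \<Rightarrow> word \<Rightarrow> state \<Rightarrow> state" where
  "search p t T' s =
     (let s1 = s\<lparr>hist := hist s @ [Search (ident (R s p)) (ident (R s t))]\<rparr>
      in if T' = word (R s t) then s1
         else (set_R t ((R s t)\<lparr>word := T'\<rparr>) s1)
                \<lparr>TsLocal := (TsLocal s)(t := p),
                 hist := hist s1 @ [Change (ident (R s t))]\<rparr>)"

definition body :: "nat \<Rightarrow> nat \<Rightarrow> state \<Rightarrow> state \<Rightarrow> bool" where
  "body p t s s' \<longleftrightarrow>
     (if guard s p t
      then \<exists>T'. ComStr (word (R s p)) (word (R s t)) T' \<and> s' = search p t T' s
      else s' = s)"

definition stamp :: "nat \<Rightarrow> state \<Rightarrow> state" where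
  "stamp p s = set_R p ((R s p)\<lparr>Tp := p, Ts := TsLocal s p\<rparr>) s"

text \<open>
  \<open>pass s \<sigma>\<close>: a run of the two nested loops from \<open>s\<close>, where \<open>\<sigma> p t\<close> is the state in which the loop
  variables have the values \<open>p\<close> and \<open>t\<close>. Thus \<open>\<sigma> p (NumRels + 1)\<close> is reached when the inner loop
  is finished. The loop for \<open>p\<close> is left with the value \<open>(NumRels - 1) + 1\<close>; this is also right for
  \<open>NumRels = 0\<close>, as the subtraction is truncated.
\<close>

definition pass :: "state \<Rightarrow> (nat \<Rightarrow> nat \<Rightarrow> state) \<Rightarrow> bool" where
  "pass s \<sigma> \<longleftrightarrow>
     \<sigma> 1 2 = s\<lparr>TsLocal := \<lambda>_. 0\<rparr> \<and>
     (\<forall>p\<in>{1..NumRels s - 1}.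
        (\<forall>t\<in>{p + 1..NumRels s}. body p t (\<sigma> p t) (\<sigma> p (t + 1))) \<and>
        \<sigma> (p + 1) (p + 2) = stamp p (\<sigma> p (NumRels s + 1)))"

definition loop_end :: "state \<Rightarrow> (nat \<Rightarrow> nat \<Rightarrow> state) \<Rightarrow> state" where
  "loop_end s \<sigma> = \<sigma> ((NumRels s - 1) + 1) ((NumRels s - 1) + 2)"

text \<open>The function \<open>sort_key\<close> is a stable sort: relators of equal length keep their order.\<close>

definition sort_Rel :: "state \<Rightarrow> state" where
  "sort_Rel s = s\<lparr>Rel := sort_key len (Rel s)\<rparr>"

text \<open>
  \<open>eliminate s s'\<close>: elimination may delete relators and may replace the words of others in any way,
  provided the new sequence is sorted. A relator whose word is kept keeps its stamps and its place
  relative to other such relators. A relator whose word is replaced is stamped as at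
  initialization: \<open>Tp\<close> and \<open>Ts\<close> are equal, and later than the stamps \<open>Tp\<close> of those that are kept.
  In particular \<open>eliminate s s\<close> holds if \<open>s\<close> is sorted and the identities are distinct.
\<close>

definition eliminate :: "state \<Rightarrow> state \<Rightarrow> bool" where
  "eliminate s s' \<longleftrightarrow>
     (let kept = filter (\<lambda>r. r \<in> set (Rel s)) (Rel s');
          replaced = filter (\<lambda>r. r \<notin> set (Rel s)) (Rel s')
      in sorted (map len (Rel s')) \<and>
         distinct (map ident (Rel s')) \<and>
         subseq kept (Rel s) \<and>
         (\<forall>r\<in>set replaced.
            (\<exists>q\<in>set (Rel s). ident q = ident r \<and> word q \<noteq> word r) \<and>
            Tp r = Ts r \<and> (\<forall>q\<in>set kept. Tp q < Tp r)) \<and>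
         hist s' = hist s @ map (\<lambda>r. Change (ident r)) replaced)"

text \<open>
  From the end of the loops to the start of the next pass. As \<open>p\<close> ranges only up to
  \<open>NumRels - 1\<close>, the loops leave stale stamps in the last relator. Bringing them up to date, by the
  same assignment as for the others, is part of the updating of \<open>Tp\<close> and \<open>Ts\<close> that is left to the
  other operations. It is written before the sorting, while the last relator is still at its
  position; the sorting does not look at the stamps.
\<close>

definition between_passes :: "state \<Rightarrow> state \<Rightarrow> bool" where
  "between_passes s s' \<longleftrightarrow> eliminate (sort_Rel (stamp (NumRels s) s)) s'"

definition initial :: "word list \<Rightarrow> state" where
  "initial ws =
     \<lparr>Rel = map (\<lambda>i. \<lparr>ident = i, word = ws ! (i - 1), Tp = i, Ts = i\<rparr>) [1..<length ws + 1],
      TsLocal = \<lambda>_. 0,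
      hist = []\<rparr>"

text \<open>
  The states at the start of a pass, in any run on the relators \<open>ws\<close>. Whether another pass is made
  is left open, which covers every choice of \<open>MoreSubstringSearchPass\<close>.
\<close>

inductive pass_start :: "word list \<Rightarrow> state \<Rightarrow> bool" for ws where
  first: "pass_start ws (initial ws)"
| again: "pass_start ws s \<Longrightarrow> pass s \<sigma> \<Longrightarrow> between_passes (loop_end s \<sigma>) s' \<Longrightarrow> pass_start ws s'"

text \<open>
  With a history \<open>h\<close>, the relators \<open>i\<close> and \<open>j\<close> are unaltered since the previous search with pattern
  \<open>i\<close> and text \<open>j\<close>. This is false if there is no such search.
\<close>

definition unchanged_since_search :: "event list \<Rightarrow> nat \<Rightarrow> nat \<Rightarrow> bool" where
  "unchanged_since_search h i j \<longleftrightarrow>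
     (\<exists>h1 h2. h = h1 @ Search i j # h2 \<and> Search i j \<notin> set h2 \<and>
              Change i \<notin> set h2 \<and> Change j \<notin> set h2)"

text \<open>The search for a pattern and a text exists only if the pattern is not longer than the text.\<close>

definition necessary_search :: "state \<Rightarrow> nat \<Rightarrow> nat \<Rightarrow> bool" where
  "necessary_search s p t \<longleftrightarrow>
     len (R s p) \<le> len (R s t) \<and>
     \<not> unchanged_since_search (hist s) (ident (R s p)) (ident (R s t))"

definition search_performed :: "state \<Rightarrow> state \<Rightarrow> nat \<Rightarrow> nat \<Rightarrow> bool" where
  "search_performed s s' p t \<longleftrightarrow>
     (\<exists>es. hist s' = hist s @ Search (ident (R s p)) (ident (R s t)) # es)"

end

theory Submission
  imports Defs
begin

text \<open>
  A search is performed exactly when the guard holds, so the claim is that, for a pattern not longer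
  than the text, the guard holds iff one of the two relators has changed since they were last
  searched in these roles, or they never were (\<open>guard_iff_necessary\<close>).

  The guard combines two sources. The entries of \<open>TsLocal\<close> tell whether one of the relators has
  already changed in the current pass; if so, the search is necessary, since this pair has not yet
  been considered in this pass. If not, everything depends on what happened before the pass, and
  the stamps have to answer correctly at the start of the pass. This is the invariant
  \<open>stamps_correct\<close>: for \<open>p < t\<close>, the stamps ask for a search iff the pair is not unchanged since
  a search. Initially all stamps ask for a search and there is no history.

  To carry the invariant through a pass, take two relators that keep their words after
  it, and that stand in the next pass as pattern and text. Let \<open>a\<close> and \<open>b\<close> be their positions in the
  finished pass, which are the values of \<open>Tp\<close> at its end.

  If \<open>a < b\<close>, they were considered in these roles, when the outer loop was at \<open>a\<close>. From then
  on the relator at \<open>a\<close> is no longer a text, so the only possible change is to the one at \<open>b\<close>,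
  by a pattern at \<open>a\<close> or later; this is what \<open>a \<le> Ts\<close> says. Without such a change their lengths
  were already in the right order when they were considered, so either the search was performed
  or, inductively, they were unchanged since an earlier one.

  If \<open>b < a\<close>, they were considered only in the opposite roles, and the stamps ask for a search.
  Their order has been reversed by the sorting, and a stable sort reverses the order of two
  relators only if their lengths have changed relative to each other. So one of them was changed in
  the pass, while every search in the present roles is older (\<open>stamps_correct_eliminate\<close>).

  A relator whose word is replaced between the passes is changed, and its fresh stamps ask for a
  search with every other relator.

  The facts about a pass that this argument uses are collected in the locale \<open>pass_invariant\<close>, whose
  preservation by the steps of the two loops is \<open>body_step\<close> and \<open>stamp_step\<close>.
\<close>

section \<open>Histories that grow at the end\<close>

lemma unchanged_since_search_Nil: "\<not> unchanged_since_search [] i j"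
  by (simp add: unchanged_since_search_def)

lemma unchanged_since_search_snoc_Search:
  "unchanged_since_search (h @ [Search a b]) i j \<longleftrightarrow>
     (a = i \<and> b = j) \<or> unchanged_since_search h i j"
proof
  assume "unchanged_since_search (h @ [Search a b]) i j"
  then obtain h1 h2 where h: "h @ [Search a b] = h1 @ Search i j # h2"
    and n: "Search i j \<notin> set h2" "Change i \<notin> set h2" "Change j \<notin> set h2"
    unfolding unchanged_since_search_def by blast
  show "(a = i \<and> b = j) \<or> unchanged_since_search h i j"
  proof (cases h2 rule: rev_cases)
    case Nil
    then show ?thesis using h by simp
  next
    case (snoc h3 e)
    then have "h = h1 @ Search i j # h3" using h by simp
    then show ?thesis using n snoc unfolding unchanged_since_search_def
      by (intro disjI2 exI[of _ h1] exI[of _ h3]) simp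
  qed
next
  assume r: "(a = i \<and> b = j) \<or> unchanged_since_search h i j"
  show "unchanged_since_search (h @ [Search a b]) i j"
  proof (cases "a = i \<and> b = j")
    case True
    then show ?thesis unfolding unchanged_since_search_def
      by (intro exI[of _ h] exI[of _ "[]"]) simp
  next
    case False
    with r obtain h1 h2 where "h = h1 @ Search i j # h2"
      "Search i j \<notin> set h2" "Change i \<notin> set h2" "Change j \<notin> set h2"
      unfolding unchanged_since_search_def by blast
    then show ?thesis using False unfolding unchanged_since_search_def
      by (intro exI[of _ h1] exI[of _ "h2 @ [Search a b]"]) auto
  qed
qed

lemma unchanged_since_search_snoc_Change:
  "unchanged_since_search (h @ [Change k]) i j \<longleftrightarrow>
     k \<noteq> i \<and> k \<noteq> j \<and> unchanged_since_search h i j"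
proof
  assume "unchanged_since_search (h @ [Change k]) i j"
  then obtain h1 h2 where h: "h @ [Change k] = h1 @ Search i j # h2"
    and n: "Search i j \<notin> set h2" "Change i \<notin> set h2" "Change j \<notin> set h2"
    unfolding unchanged_since_search_def by blast
  show "k \<noteq> i \<and> k \<noteq> j \<and> unchanged_since_search h i j"
  proof (cases h2 rule: rev_cases)
    case Nil
    then show ?thesis using h by simp
  next
    case (snoc h3 e)
    then have "h = h1 @ Search i j # h3" "e = Change k" using h by simp_all
    then show ?thesis using n snoc unfolding unchanged_since_search_def
      by (intro conjI exI[of _ h1] exI[of _ h3]) simp_all
  qed
next
  assume r: "k \<noteq> i \<and> k \<noteq> j \<and> unchanged_since_search h i j"
  then obtain h1 h2 where "h = h1 @ Search i j # h2"
    "Search i j \<notin> set h2" "Change i \<notin> set h2" "Change j \<notin> set h2"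
    unfolding unchanged_since_search_def by blast
  then show "unchanged_since_search (h @ [Change k]) i j"
    using r unfolding unchanged_since_search_def
    by (intro exI[of _ h1] exI[of _ "h2 @ [Change k]"]) auto
qed

lemma unchanged_since_search_append_Changes:
  "unchanged_since_search (h @ map Change ks) i j \<longleftrightarrow>
     i \<notin> set ks \<and> j \<notin> set ks \<and> unchanged_since_search h i j"
proof (induction ks rule: rev_induct)
  case (snoc k ks)
  have "unchanged_since_search (h @ map Change (ks @ [k])) i j \<longleftrightarrow>
      k \<noteq> i \<and> k \<noteq> j \<and> unchanged_since_search (h @ map Change ks) i j"
    using unchanged_since_search_snoc_Change[of "h @ map Change ks" k i j] by simp
  then show ?case using snoc.IH by auto
qed simp


section \<open>Stable sorting\<close>

text \<open>
  The order in which a stable sort by length leaves relators whose stamps \<open>Tp\<close> were increasing.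
\<close>

definition len_Tp_less :: "relator \<Rightarrow> relator \<Rightarrow> bool" where
  "len_Tp_less x y \<longleftrightarrow> len x < len y \<or> len x = len y \<and> Tp x < Tp y"

text \<open>
  Insertion puts \<open>x\<close> before the entries of equal length, which is where its smaller \<open>Tp\<close> belongs.
\<close>

lemma sorted_wrt_insort_key_len:
  assumes "sorted_wrt len_Tp_less xs" and "\<forall>y\<in>set xs. Tp x < Tp y"
  shows "sorted_wrt len_Tp_less (insort_key len x xs)"
  using assms
proof (induction xs)
  case (Cons a xs)
  show ?case
  proof (cases "len x \<le> len a")
    case True
    have "len_Tp_less x y" if "y \<in> set (a # xs)" for y
    proof -
      have "y = a \<or> len_Tp_less a y" using Cons.prems(1) that by auto
      then have "len x \<le> len y" using True by (auto simp: len_Tp_less_def)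
      moreover have "Tp x < Tp y" using Cons.prems(2) that by blast
      ultimately show ?thesis by (auto simp: len_Tp_less_def)
    qed
    then show ?thesis using Cons.prems(1) True by simp
  next
    case False
    then have "len_Tp_less a x" by (simp add: len_Tp_less_def)
    then show ?thesis using Cons False by (auto simp: set_insort_key)
  qed
qed simp

lemma sorted_wrt_sort_key_len:
  "sorted_wrt (\<lambda>x y. Tp x < Tp y) xs \<Longrightarrow> sorted_wrt len_Tp_less (sort_key len xs)"
  by (induction xs) (auto intro!: sorted_wrt_insort_key_len)

lemma sorted_wrt_subseq:
  assumes "subseq xs ys" and "sorted_wrt P ys"
  shows "sorted_wrt P xs"
  using assms
proof (induction rule: list_emb.induct)
  case (list_emb_Cons2 x y xs ys)
  then show ?case using list_emb_set by fastforce
qed auto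

lemma sorted_wrt_filter_iff:
  "sorted_wrt P (filter Q xs) \<longleftrightarrow> sorted_wrt (\<lambda>x y. Q x \<longrightarrow> Q y \<longrightarrow> P x y) xs"
  by (induction xs) auto


section \<open>Updates of a state\<close>

lemma NumRels_set_R [simp]: "NumRels (set_R k r s) = NumRels s"
  by (simp add: set_R_def)

lemma R_set_R:
  assumes "1 \<le> k" "k \<le> NumRels s" "1 \<le> i"
  shows "R (set_R k r s) i = (if i = k then r else R s i)"
proof -
  have "i - 1 = k - 1 \<longleftrightarrow> i = k" using assms by auto
  then show ?thesis using assms by (auto simp: R_def set_R_def nth_list_update)
qed

lemma TsLocal_set_R [simp]: "TsLocal (set_R k r s) = TsLocal s"
  by (simp add: set_R_def)

lemma hist_set_R [simp]: "hist (set_R k r s) = hist s"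
  by (simp add: set_R_def)

lemma R_update [simp]:
  "R (s\<lparr>TsLocal := f\<rparr>) = R s" "R (s\<lparr>hist := h\<rparr>) = R s"
  by (simp_all add: R_def fun_eq_iff)

lemma search_same:
  assumes "T' = word (R s t)"
  shows "search p t T' s = s\<lparr>hist := hist s @ [Search (ident (R s p)) (ident (R s t))]\<rparr>"
  using assms by (simp add: search_def Let_def)

lemma search_changed:
  assumes "T' \<noteq> word (R s t)" "1 \<le> t" "t \<le> NumRels s"
  shows "NumRels (search p t T' s) = NumRels s"
    and "1 \<le> i \<Longrightarrow> R (search p t T' s) i = (if i = t then (R s t)\<lparr>word := T'\<rparr> else R s i)"
    and "TsLocal (search p t T' s) = (TsLocal s)(t := p)"
    and "hist (search p t T' s) =
           (hist s @ [Search (ident (R s p)) (ident (R s t))]) @ [Change (ident (R s t))]"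
  using assms by (simp_all add: search_def Let_def R_set_R)

lemma search_performed_iff_guard:
  assumes "body p t s s'"
  shows "search_performed s s' p t \<longleftrightarrow> guard s p t"
proof (cases "guard s p t")
  case True
  then obtain T' where "s' = search p t T' s" using assms by (auto simp: body_def)
  then show ?thesis using True by (auto simp: search_performed_def search_def Let_def)
next
  case False
  then show ?thesis using assms by (simp add: body_def search_performed_def)
qed


section \<open>The invariant at the start of a pass\<close>

text \<open>Histories speak of identities, the algorithm of positions.\<close>

abbreviation unchanged :: "state \<Rightarrow> nat \<Rightarrow> nat \<Rightarrow> bool" where
  "unchanged s i j \<equiv> unchanged_since_search (hist s) (ident (R s i)) (ident (R s j))"

text \<open>The part of the guard that depends on previous passes.\<close>

definition stamp_test :: "state \<Rightarrow> nat \<Rightarrow> nat \<Rightarrow> bool" where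
  "stamp_test s p t \<longleftrightarrow> Tp (R s p) > Tp (R s t) \<or> Tp (R s p) \<le> Ts (R s t)"

definition stamps_correct :: "state \<Rightarrow> bool" where
  "stamps_correct s \<longleftrightarrow>
     distinct (map ident (Rel s)) \<and> sorted (map len (Rel s)) \<and>
     (\<forall>p t. 1 \<le> p \<longrightarrow> p < t \<longrightarrow> t \<le> NumRels s \<longrightarrow> (stamp_test s p t \<longleftrightarrow> \<not> unchanged s p t))"

lemma stamps_correct_ident_eq_iff:
  assumes "stamps_correct s" "1 \<le> i" "i \<le> NumRels s" "1 \<le> j" "j \<le> NumRels s"
  shows "ident (R s i) = ident (R s j) \<longleftrightarrow> i = j"
proof -
  have "ident (R s i) = ident (R s j) \<longleftrightarrow> i - 1 = j - 1"
    using assms nth_eq_iff_index_eq[of "map ident (Rel s)" "i - 1" "j - 1"]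
    by (auto simp: stamps_correct_def R_def)
  then show ?thesis using assms by auto
qed

text \<open>
  With \<open>Tp = Ts = k\<close> at position \<open>k\<close>, the test \<open>Tp \<le> Ts\<close> holds for every pattern and every later text,
  and the empty history makes every search necessary.
\<close>

lemma stamps_correct_initial:
  assumes "sorted (map length ws)"
  shows "stamps_correct (initial ws)"
proof -
  have R: "R (initial ws) k = \<lparr>ident = k, word = ws ! (k - 1), Tp = k, Ts = k\<rparr>"
    if "1 \<le> k" "k \<le> length ws" for k
    using that nth_upt[of 1 "k - 1" "length ws + 1"] by (simp add: R_def initial_def del: upt_Suc)
  have "map ident (Rel (initial ws)) = [1..<length ws + 1]"
    by (simp add: initial_def comp_def del: upt_Suc)
  moreover have "map len (Rel (initial ws)) = map length ws"
    by (rule nth_equalityI) (auto simp: initial_def simp del: upt_Suc)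
  moreover have "hist (initial ws) = []" "NumRels (initial ws) = length ws"
    by (auto simp: initial_def simp del: upt_Suc)
  ultimately show ?thesis
    using assms by (auto simp: stamps_correct_def stamp_test_def R unchanged_since_search_Nil
        simp del: upt_Suc)
qed


section \<open>The invariant within a pass\<close>

text \<open>
  The pairs that the loops have dealt with when the loop variables become \<open>p\<close> and \<open>t\<close>.
\<close>

definition visited :: "nat \<Rightarrow> nat \<Rightarrow> nat \<Rightarrow> nat \<Rightarrow> bool" where
  "visited p t i j \<longleftrightarrow> i < j \<and> (i < p \<or> i = p \<and> j < t)"

text \<open>
  A comparison of the state \<open>u\<close>, reached with loop variables \<open>p\<close> and \<open>t\<close>, with the state \<open>s\<close> at the
  start of the pass. The fact \<open>TsLocal_less\<close> holds because only positions strictly between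
  \<open>p\<close> and \<open>t\<close> have been texts for the pattern \<open>p\<close>. The last two facts determine the search status
  of every pair. A pair not yet visited, in particular every pair \<open>i > j\<close>, has had no search in this
  pass, so it is unchanged iff it was so at the start and neither relator has changed since. For a
  visited pair \<open>i < j\<close>, position \<open>i\<close> changes only by patterns before \<open>i\<close>; hence \<open>TsLocal u j\<close>
  alone tells whether a change came after the visit. Its premise leaves out the visits at which the
  pattern was the longer relator and which no change of the text has followed: there the search
  may be missing.
\<close>

locale pass_invariant =
  fixes s :: state and p t :: nat and u :: state
  assumes num: "NumRels u = NumRels s"
    and ident: "\<And>k. 1 \<le> k \<Longrightarrow> k \<le> NumRels s \<Longrightarrow> ident (R u k) = ident (R s k)"
    and TsLocal_le: "\<And>k. TsLocal u k \<le> p"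
    and TsLocal_less: "\<And>k. k \<le> p \<or> t \<le> k \<Longrightarrow> TsLocal u k < p"
    and word: "\<And>k. 1 \<le> k \<Longrightarrow> k \<le> NumRels s \<Longrightarrow> TsLocal u k = 0 \<Longrightarrow> word (R u k) = word (R s k)"
    and old_stamps: "\<And>k. p \<le> k \<Longrightarrow> k \<le> NumRels s \<Longrightarrow> Tp (R u k) = Tp (R s k) \<and> Ts (R u k) = Ts (R s k)"
    and new_stamps: "\<And>k. 1 \<le> k \<Longrightarrow> k < p \<Longrightarrow> Tp (R u k) = k \<and> Ts (R u k) = TsLocal u k"
    and unvisited: "\<And>i j. 1 \<le> i \<Longrightarrow> i \<le> NumRels s \<Longrightarrow> 1 \<le> j \<Longrightarrow> j \<le> NumRels s \<Longrightarrow> i \<noteq> j \<Longrightarrow>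
        \<not> visited p t i j \<Longrightarrow>
        unchanged u i j \<longleftrightarrow> unchanged s i j \<and> TsLocal u i = 0 \<and> TsLocal u j = 0"
    and visited: "\<And>i j. 1 \<le> i \<Longrightarrow> j \<le> NumRels s \<Longrightarrow> visited p t i j \<Longrightarrow>
        len (R u i) \<le> len (R u j) \<or> i \<le> TsLocal u j \<Longrightarrow>
        unchanged u i j \<longleftrightarrow> TsLocal u j < i"

lemma pass_invariant_init:
  "pass_invariant s 1 2 (s\<lparr>TsLocal := \<lambda>_. 0\<rparr>)"
  by unfold_locales (auto simp: visited_def)

context pass_invariant
begin

lemma guard_iff_necessary:
  assumes "stamps_correct s" "1 \<le> p" "p < t" "t \<le> NumRels s"
  shows "guard u p t \<longleftrightarrow> necessary_search u p t"
proof -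
  have "unchanged u p t \<longleftrightarrow> unchanged s p t \<and> TsLocal u p = 0 \<and> TsLocal u t = 0"
    using assms by (intro unvisited) (auto simp: visited_def)
  moreover have "stamp_test s p t \<longleftrightarrow> \<not> unchanged s p t"
    using assms by (simp add: stamps_correct_def)
  moreover have "stamp_test u p t \<longleftrightarrow> stamp_test s p t"
    using assms by (simp add: stamp_test_def old_stamps)
  ultimately show ?thesis
    by (auto simp: guard_def necessary_search_def stamp_test_def)
qed

text \<open>
  The pair \<open>(p, t)\<close> becomes visited. If the search is skipped although the pattern is not longer, the
  pair is unchanged since an earlier one, by the correctness of the guard; a performed search makes it so, unless the text changes, and then
  \<open>TsLocal\<close> becomes \<open>p\<close> at \<open>t\<close>. A change of the text is visible in \<open>TsLocal\<close> to every other
  pair that contains it: to the visited ones, where it is the text of a pattern \<open>i < p\<close>,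
  as a value \<open>p \<ge> i\<close>, to the others as a nonzero value.
\<close>

lemma body_step:
  assumes s: "stamps_correct s" and pt: "1 \<le> p" "p < t" "t \<le> NumRels s"
    and step: "body p t u u'"
  shows "pass_invariant s p (t + 1) u'"
proof -
  have visited_Suc: "visited p (Suc t) i j \<longleftrightarrow> visited p t i j \<or> i = p \<and> j = t" for i j
    using pt by (auto simp: visited_def)
  have id_eq: "ident (R u i) = ident (R u j) \<longleftrightarrow> i = j"
    if "1 \<le> i" "i \<le> NumRels s" "1 \<le> j" "j \<le> NumRels s" for i j
    using stamps_correct_ident_eq_iff[OF s that] that by (simp add: ident)
  consider (skip) "\<not> guard u p t" "u' = u"
    | (same) T' where "guard u p t" "u' = search p t T' u" "T' = word (R u t)"
    | (changed) T' where "guard u p t" "u' = search p t T' u" "T' \<noteq> word (R u t)"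
    using step unfolding body_def by metis
  then show ?thesis
  proof cases
    case skip
    have "unchanged u p t" if "len (R u p) \<le> len (R u t)"
      using skip(1) that guard_iff_necessary[OF s pt] by (simp add: necessary_search_def)
    moreover have "TsLocal u t < p" using TsLocal_less by simp
    ultimately have last: "unchanged u p t \<longleftrightarrow> TsLocal u t < p"
      if "len (R u p) \<le> len (R u t) \<or> p \<le> TsLocal u t"
      using that by auto
    show ?thesis
      unfolding skip(2)
    proof
      fix i j assume "1 \<le> i" "i \<le> NumRels s" "1 \<le> j" "j \<le> NumRels s" "i \<noteq> j"
        "\<not> visited p (t + 1) i j"
      then show "unchanged u i j \<longleftrightarrow> unchanged s i j \<and> TsLocal u i = 0 \<and> TsLocal u j = 0"
        using unvisited[of i j] by (simp add: visited_Suc)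
    next
      fix i j assume "1 \<le> i" "j \<le> NumRels s" "visited p (t + 1) i j"
        "len (R u i) \<le> len (R u j) \<or> i \<le> TsLocal u j"
      then show "unchanged u i j \<longleftrightarrow> TsLocal u j < i"
        using last visited[of i j] by (auto simp: visited_Suc)
    next
      fix k assume "k \<le> p \<or> t + 1 \<le> k"
      then show "TsLocal u k < p" using TsLocal_less[of k] by auto
    qed (simp_all add: num ident TsLocal_le word old_stamps new_stamps)
  next
    case same
    have u': "u' = u\<lparr>hist := hist u @ [Search (ident (R u p)) (ident (R u t))]\<rparr>"
      using search_same[OF same(3), of p] same(2) by simp
    have un: "unchanged u' i j \<longleftrightarrow> i = p \<and> j = t \<or> unchanged u i j"
      if "1 \<le> i" "i \<le> NumRels s" "1 \<le> j" "j \<le> NumRels s" for i j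
      using that pt id_eq[of p i] id_eq[of t j]
      by (auto simp: u' unchanged_since_search_snoc_Search)
    have f: "NumRels u' = NumRels u" "R u' = R u" "TsLocal u' = TsLocal u"
      by (simp_all add: u')
    show ?thesis
    proof
      fix i j assume ij: "1 \<le> i" "i \<le> NumRels s" "1 \<le> j" "j \<le> NumRels s" "i \<noteq> j"
        "\<not> visited p (t + 1) i j"
      then show "unchanged u' i j \<longleftrightarrow> unchanged s i j \<and> TsLocal u' i = 0 \<and> TsLocal u' j = 0"
        using un[of i j] unvisited[of i j] f by (auto simp: visited_Suc)
    next
      fix i j assume ij: "1 \<le> i" "j \<le> NumRels s" "visited p (t + 1) i j"
        "len (R u' i) \<le> len (R u' j) \<or> i \<le> TsLocal u' j"
      moreover have "i < j" using ij(3) by (simp add: visited_def)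
      moreover have "TsLocal u t < p" using TsLocal_less by simp
      ultimately show "unchanged u' i j \<longleftrightarrow> TsLocal u' j < i"
        using un[of i j] visited[of i j] f by (auto simp: visited_Suc)
    next
      fix k assume "k \<le> p \<or> t + 1 \<le> k"
      then show "TsLocal u' k < p" using TsLocal_less[of k] f by auto
    qed (simp_all add: f num ident TsLocal_le word old_stamps new_stamps)
  next
    case changed
    have t: "1 \<le> t" "t \<le> NumRels u" using pt num by simp_all
    note u' = search_changed[OF changed(3) t, where p = p, folded changed(2)]
    have id': "ident (R u' i) = ident (R u i)" if "1 \<le> i" for i
      using u'(2)[OF that] by simp
    have un: "unchanged u' i j \<longleftrightarrow> i \<noteq> t \<and> j \<noteq> t \<and> unchanged u i j"
      if "1 \<le> i" "i \<le> NumRels s" "1 \<le> j" "j \<le> NumRels s" for i j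
      unfolding u'(4) id'[OF that(1)] id'[OF that(3)]
        unchanged_since_search_snoc_Change unchanged_since_search_snoc_Search
      using that pt id_eq[of t i] id_eq[of t j] by auto
    show ?thesis
    proof
      fix i j assume ij: "1 \<le> i" "i \<le> NumRels s" "1 \<le> j" "j \<le> NumRels s" "i \<noteq> j"
        "\<not> visited p (t + 1) i j"
      then show "unchanged u' i j \<longleftrightarrow> unchanged s i j \<and> TsLocal u' i = 0 \<and> TsLocal u' j = 0"
        using un[of i j] unvisited[of i j] pt by (auto simp: visited_Suc u'(3))
    next
      fix i j assume ij: "1 \<le> i" "j \<le> NumRels s" "visited p (t + 1) i j"
        "len (R u' i) \<le> len (R u' j) \<or> i \<le> TsLocal u' j"
      then have lt: "i < j" "i \<noteq> t" "i \<le> p" using pt by (auto simp: visited_def)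
      show "unchanged u' i j \<longleftrightarrow> TsLocal u' j < i"
      proof (cases "j = t")
        case True
        then show ?thesis using un[of i j] ij lt by (simp add: u'(3))
      next
        case False
        then have "R u' i = R u i" "R u' j = R u j" using u'(2) ij lt by simp_all
        then show ?thesis
          using un[of i j] visited[of i j] ij lt False by (auto simp: visited_Suc u'(3))
      qed
    next
      fix k assume "k \<le> p \<or> t + 1 \<le> k"
      then show "TsLocal u' k < p" using TsLocal_less[of k] pt by (auto simp: u'(3))
    next
      fix k assume "1 \<le> k" "k \<le> NumRels s" "TsLocal u' k = 0"
      then show "word (R u' k) = word (R s k)"
        using word[of k] pt by (auto simp: u'(2,3) split: if_splits)
    qed (use pt in \<open>simp_all add: u'(1-3) num ident TsLocal_le old_stamps new_stamps\<close>)
  qed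
qed

text \<open>
  After its turn as a pattern, the relator at \<open>p\<close> is not a text any more, so that the value of
  \<open>TsLocal\<close> saved in \<open>Ts\<close> is final for this pass.
\<close>

lemma stamp_step:
  assumes p: "1 \<le> p" "p \<le> NumRels s" and t: "t = NumRels s + 1"
  shows "pass_invariant s (p + 1) (p + 2) (stamp p u)"
proof -
  have pu: "p \<le> NumRels u" using p num by simp
  have f: "NumRels (stamp p u) = NumRels u" "TsLocal (stamp p u) = TsLocal u"
    "hist (stamp p u) = hist u"
    by (simp_all add: stamp_def)
  have R: "R (stamp p u) k = (if k = p then (R u p)\<lparr>Tp := p, Ts := TsLocal u p\<rparr> else R u k)"
    if "1 \<le> k" for k
    using R_set_R[OF p(1) pu that] by (simp add: stamp_def)
  have eqs: "ident (R (stamp p u) k) = ident (R u k)" "word (R (stamp p u) k) = word (R u k)"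
    if "1 \<le> k" for k using R[OF that] by simp_all
  have vis: "visited (p + 1) (p + 2) i j \<longleftrightarrow> visited p t i j" if "j \<le> NumRels s" for i j
    using that t by (auto simp: visited_def)
  show ?thesis
  proof
    fix i j assume ij: "1 \<le> i" "i \<le> NumRels s" "1 \<le> j" "j \<le> NumRels s" "i \<noteq> j"
      "\<not> visited (p + 1) (p + 2) i j"
    then show "unchanged (stamp p u) i j \<longleftrightarrow>
        unchanged s i j \<and> TsLocal (stamp p u) i = 0 \<and> TsLocal (stamp p u) j = 0"
      using unvisited[of i j] vis[of j i] by (simp add: f eqs)
  next
    fix i j assume ij: "1 \<le> i" "j \<le> NumRels s" "visited (p + 1) (p + 2) i j"
      "len (R (stamp p u) i) \<le> len (R (stamp p u) j) \<or> i \<le> TsLocal (stamp p u) j"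
    moreover have "1 \<le> j" using ij(1,3) by (auto simp: visited_def)
    ultimately show "unchanged (stamp p u) i j \<longleftrightarrow> TsLocal (stamp p u) j < i"
      using visited[of i j] vis[of j i] by (simp add: f eqs)
  next
    fix k show "TsLocal (stamp p u) k \<le> p + 1" "TsLocal (stamp p u) k < p + 1"
      using TsLocal_le[of k] by (simp_all add: f)
  next
    fix k assume "1 \<le> k" "k < p + 1"
    then show "Tp (R (stamp p u) k) = k \<and> Ts (R (stamp p u) k) = TsLocal (stamp p u) k"
      using new_stamps[of k] R[of k] by (auto simp: f)
  next
    fix k assume "1 \<le> k" "k \<le> NumRels s" "TsLocal (stamp p u) k = 0"
    then show "word (R (stamp p u) k) = word (R s k)" using word[of k] by (simp add: f eqs)
  qed (use p in \<open>simp_all add: f eqs R num ident old_stamps\<close>)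
qed

end

lemma pass_first: "pass s \<sigma> \<Longrightarrow> \<sigma> 1 2 = s\<lparr>TsLocal := \<lambda>_. 0\<rparr>"
  unfolding pass_def by (rule conjunct1)

lemma pass_body:
  assumes "pass s \<sigma>" "1 \<le> p" "p < t" "t \<le> NumRels s"
  shows "body p t (\<sigma> p t) (\<sigma> p (t + 1))"
proof -
  have "p \<in> {1..NumRels s - 1}" "t \<in> {p + 1..NumRels s}" using assms(2-4) by auto
  then show ?thesis using assms(1)[unfolded pass_def, THEN conjunct2] by blast
qed

lemma pass_stamp:
  assumes "pass s \<sigma>" "1 \<le> p" "p < NumRels s"
  shows "\<sigma> (p + 1) (p + 2) = stamp p (\<sigma> p (NumRels s + 1))"
proof -
  have "p \<in> {1..NumRels s - 1}" using assms(2,3) by auto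
  then show ?thesis using assms(1)[unfolded pass_def, THEN conjunct2] by blast
qed

lemma pass_invariant_inner:
  assumes s: "stamps_correct s" and ps: "pass s \<sigma>" and p: "1 \<le> p" "p < NumRels s"
    and start: "pass_invariant s p (p + 1) (\<sigma> p (p + 1))"
    and t: "p + 1 \<le> t" "t \<le> NumRels s + 1"
  shows "pass_invariant s p t (\<sigma> p t)"
  using t(1)
proof (induction t rule: dec_induct)
  case base
  show ?case by (fact start)
next
  case (step k)
  have k: "p < k" "k \<le> NumRels s" using step.hyps t(2) by simp_all
  show ?case
    using pass_invariant.body_step[OF step.IH s p(1) k pass_body[OF ps p(1) k]] by simp
qed

lemma pass_invariant_outer:
  assumes s: "stamps_correct s" and ps: "pass s \<sigma>" and p: "1 \<le> p" "p \<le> NumRels s"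
  shows "pass_invariant s p (p + 1) (\<sigma> p (p + 1))"
  using p(1)
proof (induction p rule: dec_induct)
  case base
  show ?case using pass_invariant_init[of s] pass_first[OF ps] by (simp add: numeral_2_eq_2)
next
  case (step k)
  have k: "1 \<le> k" "k < NumRels s" using step.hyps p(2) by simp_all
  have "pass_invariant s k (NumRels s + 1) (\<sigma> k (NumRels s + 1))"
    using pass_invariant_inner[OF s ps k step.IH] k by simp
  then have "pass_invariant s (k + 1) (k + 2) (stamp k (\<sigma> k (NumRels s + 1)))"
    using pass_invariant.stamp_step k by simp
  then show ?case using pass_stamp[OF ps k] by simp
qed

text \<open>
  The last relator is stamped between the passes; with this, the situation is as if the outer loop
  had run up to \<open>NumRels\<close>, where its inner loop is empty. All stamps are then those of the
  finished pass.
\<close>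

lemma pass_invariant_stamped_loop_end:
  assumes s: "stamps_correct s" and ps: "pass s \<sigma>" and N: "1 \<le> NumRels s"
  shows "pass_invariant s (NumRels s + 1) (NumRels s + 2)
           (stamp (NumRels (loop_end s \<sigma>)) (loop_end s \<sigma>))"
proof -
  have e: "loop_end s \<sigma> = \<sigma> (NumRels s) (NumRels s + 1)"
  proof -
    have "NumRels s - 1 + 1 = NumRels s" "NumRels s - 1 + 2 = NumRels s + 1" using N by simp_all
    then show ?thesis by (simp only: loop_end_def)
  qed
  have inv: "pass_invariant s (NumRels s) (NumRels s + 1) (loop_end s \<sigma>)"
    using pass_invariant_outer[OF s ps N] by (simp add: e)
  show ?thesis
    using pass_invariant.stamp_step[OF inv N] pass_invariant.num[OF inv] by simp
qed


section \<open>From one pass to the next\<close>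

text \<open>
  The heart of the proof. The premise on \<open>v\<close> says that it is the stamped state at the end of a pass
  from \<open>s\<close>. Relators that are kept are ordered by length and then by their position in that pass.
  If \<open>a < b\<close>, this gives the order of lengths under which a visited pair is known to have been
  searched or to be still unchanged; if \<open>b < a\<close>, it gives a strict inequality, hence a change.
\<close>

lemma stamps_correct_eliminate:
  assumes s: "stamps_correct s"
    and inv: "pass_invariant s (NumRels s + 1) (NumRels s + 2) v"
    and elim: "eliminate (sort_Rel v) s'"
  shows "stamps_correct s'"
proof -
  interpret pass_invariant s "NumRels s + 1" "NumRels s + 2" v by (fact inv)
  define kept where "kept = filter (\<lambda>r. r \<in> set (Rel v)) (Rel s')"
  define replaced where "replaced = filter (\<lambda>r. r \<notin> set (Rel v)) (Rel s')"
  have srt: "sorted (map len (Rel s'))" and dist: "distinct (map ident (Rel s'))"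
    and sub: "subseq kept (sort_key len (Rel v))"
    and repl: "\<And>r. r \<in> set replaced \<Longrightarrow> Tp r = Ts r \<and> (\<forall>q\<in>set kept. Tp q < Tp r)"
    and hist: "hist s' = hist v @ map Change (map ident replaced)"
    using elim by (auto simp: eliminate_def sort_Rel_def Let_def kept_def replaced_def comp_def)
  have Tp_v: "Tp (R v k) = k" "Ts (R v k) = TsLocal v k" if "1 \<le> k" "k \<le> NumRels s" for k
    using new_stamps[of k] that by simp_all
  have "sorted_wrt (\<lambda>x y. Tp x < Tp y) (Rel v)"
  proof (unfold sorted_wrt_iff_nth_less, intro allI impI)
    fix i j assume "i < j" "j < NumRels v"
    then show "Tp (Rel v ! i) < Tp (Rel v ! j)"
      using Tp_v(1)[of "i + 1"] Tp_v(1)[of "j + 1"] num by (simp add: R_def)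
  qed
  then have "sorted_wrt len_Tp_less kept"
    using sorted_wrt_subseq[OF sub] sorted_wrt_sort_key_len by blast
  then have kept_order:
    "sorted_wrt (\<lambda>x y. x \<in> set (Rel v) \<longrightarrow> y \<in> set (Rel v) \<longrightarrow> len_Tp_less x y) (Rel s')"
    by (simp add: kept_def sorted_wrt_filter_iff)
  have "stamp_test s' p t \<longleftrightarrow> \<not> unchanged s' p t"
    if pt: "1 \<le> p" "p < t" "t \<le> NumRels s'" for p t
  proof -
    let ?x = "R s' p" and ?y = "R s' t"
    have mem: "?x \<in> set (Rel s')" "?y \<in> set (Rel s')" using pt by (auto simp: R_def)
    have un: "unchanged s' p t \<longleftrightarrow> ident ?x \<notin> ident ` set replaced \<and> ident ?y \<notin> ident ` set replaced \<and>
        unchanged_since_search (hist v) (ident ?x) (ident ?y)"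
      unfolding hist unchanged_since_search_append_Changes by simp
    have inj: "inj_on ident (set (Rel s'))" using dist by (simp add: distinct_map)
    have replaced_iff: "ident r \<in> ident ` set replaced \<longleftrightarrow> r \<notin> set (Rel v)" if "r \<in> set (Rel s')" for r
      using that inj by (auto simp: replaced_def inj_on_def)
    show ?thesis
    proof (cases "?x \<in> set (Rel v) \<and> ?y \<in> set (Rel v)")
      case False
      then have "\<not> unchanged s' p t" using un replaced_iff mem by blast
      moreover have "stamp_test s' p t"
      proof (cases "?y \<in> set (Rel v)")
        case True
        then have "?x \<in> set replaced" "?y \<in> set kept"
          using False mem by (simp_all add: replaced_def kept_def)
        then have "Tp ?y < Tp ?x" using repl by blast
        then show ?thesis by (simp add: stamp_test_def)
      next
        case nk: False
        then have y: "?y \<in> set replaced" using mem by (simp add: replaced_def)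
        then have "Tp ?y = Ts ?y" using repl by blast
        then show ?thesis by (auto simp: stamp_test_def)
      qed
      ultimately show ?thesis by simp
    next
      case True
      obtain a where a: "1 \<le> a" "a \<le> NumRels s" "?x = R v a"
      proof -
        from True obtain i where "i < NumRels v" "Rel v ! i = ?x" by (metis in_set_conv_nth)
        then show ?thesis using that[of "i + 1"] num by (simp add: R_def)
      qed
      obtain b where b: "1 \<le> b" "b \<le> NumRels s" "?y = R v b"
      proof -
        from True obtain i where "i < NumRels v" "Rel v ! i = ?y" by (metis in_set_conv_nth)
        then show ?thesis using that[of "i + 1"] num by (simp add: R_def)
      qed
      have "p - 1 < t - 1" "t - 1 < NumRels s'" using pt by auto
      then have "len_Tp_less ?x ?y"
        using kept_order True unfolding sorted_wrt_iff_nth_less R_def by blast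
      then have less: "len (R v a) < len (R v b) \<or> len (R v a) = len (R v b) \<and> a < b"
        using a b Tp_v by (simp add: len_Tp_less_def)
      have un': "unchanged s' p t \<longleftrightarrow> unchanged v a b"
        using un replaced_iff mem True a b by simp
      have test: "stamp_test s' p t \<longleftrightarrow> b < a \<or> a \<le> TsLocal v b"
        using a b Tp_v by (simp add: stamp_test_def)
      show ?thesis
      proof (cases "a < b")
        case True
        then have "unchanged v a b \<longleftrightarrow> TsLocal v b < a"
          using a b less by (intro visited) (auto simp: visited_def)
        then show ?thesis using un' test True by auto
      next
        case False
        then have ba: "b < a" using less by (cases "a = b") auto
        (* At the start of the pass b came before a with length at most that of a, now it is strictly
           longer: one of the two has changed. *)
        have "sorted (map len (Rel s))" using s by (simp add: stamps_correct_def)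
        then have "len (R s b) \<le> len (R s a)"
          using sorted_nth_mono[of "map len (Rel s)" "b - 1" "a - 1"] ba a b by (simp add: R_def)
        then have "word (R v a) \<noteq> word (R s a) \<or> word (R v b) \<noteq> word (R s b)"
          using less ba by auto
        then have "TsLocal v a \<noteq> 0 \<or> TsLocal v b \<noteq> 0"
          using word[of a] word[of b] a b by blast
        then have "\<not> unchanged v a b"
          using unvisited[of a b] a b ba by (auto simp: visited_def)
        then show ?thesis using un' test ba by simp
      qed
    qed
  qed
  then show ?thesis using srt dist by (simp add: stamps_correct_def)
qed

lemma stamps_correct_pass_start:
  assumes "pass_start ws s" and "sorted (map length ws)"
  shows "stamps_correct s"
  using assms(1)
proof induction
  case first
  show ?case using stamps_correct_initial assms(2) .
next
  case (again s \<sigma> s')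
  let ?v = "stamp (NumRels (loop_end s \<sigma>)) (loop_end s \<sigma>)"
  have elim: "eliminate (sort_Rel ?v) s'" using again.hyps by (simp add: between_passes_def)
  show ?case
  proof (cases "NumRels s = 0")
    case True
    (* Replaced relators stem from existing ones, so an empty sequence stays empty. *)
    then have "NumRels ?v = 0"
      using pass_first[OF again.hyps(2)]
      by (simp add: loop_end_def stamp_def numeral_2_eq_2)
    then have "set (Rel (sort_Rel ?v)) = {}" by (simp add: sort_Rel_def)
    moreover have "r \<in> set (Rel (sort_Rel ?v)) \<or> (\<exists>q\<in>set (Rel (sort_Rel ?v)). ident q = ident r)"
      if "r \<in> set (Rel s')" for r
      using elim that by (auto simp: eliminate_def Let_def)
    ultimately have "Rel s' = []" by (metis empty_iff set_empty equals0I)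
    then show ?thesis by (simp add: stamps_correct_def)
  next
    case False
    then have "1 \<le> NumRels s" by (simp add: Suc_le_eq)
    then show ?thesis
      by (rule stamps_correct_eliminate[OF again.IH
            pass_invariant_stamped_loop_end[OF again.IH again.hyps(2)] elim])
  qed
qed


section \<open>Searches are performed exactly when they are necessary\<close>

theorem theorem2:
  fixes d :: nat and ws :: "word list"
  assumes "set ws \<subseteq> lists (alphabet d)"
    and "sorted (map length ws)"
    and "pass_start ws s"
    and "pass s \<sigma>"
    and "1 \<le> p" and "p < t" and "t \<le> NumRels s"
  shows "(necessary_search (\<sigma> p t) p t \<longrightarrow> search_performed (\<sigma> p t) (\<sigma> p (t + 1)) p t) \<and>
         (search_performed (\<sigma> p t) (\<sigma> p (t + 1)) p t \<longrightarrow> necessary_search (\<sigma> p t) p t)"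
proof -
  have s: "stamps_correct s" using stamps_correct_pass_start assms(2,3) by blast
  have "pass_invariant s p (p + 1) (\<sigma> p (p + 1))"
    using pass_invariant_outer[OF s assms(4,5)] assms(6,7) by simp
  then have "pass_invariant s p t (\<sigma> p t)"
    using pass_invariant_inner[OF s assms(4,5)] assms(6,7) by simp
  then have "guard (\<sigma> p t) p t \<longleftrightarrow> necessary_search (\<sigma> p t) p t"
    using pass_invariant.guard_iff_necessary s assms(5,6,7) by blast
  moreover have "search_performed (\<sigma> p t) (\<sigma> p (t + 1)) p t \<longleftrightarrow> guard (\<sigma> p t) p t"
    using search_performed_iff_guard pass_body assms(4-7) by blast
  ultimately show ?thesis by simp
qed

end
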